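(* Let $\mathbb{L}$ be a (not necessarily commutative) ring with unity. Let $V$ be a finite set and $n=|V|$. For each $s\in V$, let $x_s\in\mathbb{L}$. Let $X,Y\in\mathbb{L}$ be such that $X+Y$ lies in the center of $\mathbb{L}$. Then \[ \sum_{S\subseteq V}X\Big(X+\sum_{s\in S}x_s\Big)^{|S|-1}\Big(Y-\sum_{s\in S}x_s\Big)^{n-|S|-1}\Big(Y-\sum_{s\in V}x_s\Big)=\Big(X+Y-\sum_{s\in V}x_s\Big)(X+Y)^{n-1}, \] with the following interpretations: the product $X\big(X+\sum_{s\in S}x_s\big)^{|S|-1}$ is interpreted as $1$ when $S=\varnothing$; the product $\big(Y-\sum_{s\in S}x_s\big)^{n-|S|-1}\big(Y-\sum_{s\in V}x_s\big)$ is interpreted as $1$ when $|S|=n$; and the product $\big(X+Y-\sum_{s\in V}x_s\big)(X+Y)^{n-1}$ is interpreted as $1$ when $n=0$. *)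

theory Defs
  imports Main
begin

definition center :: "'a::{ring, monoid_mult} set"
  where "center = {z. \<forall>a. z * a = a * z}"

(* The sort {ring, monoid_mult} describes all rings with unity; unlike ring_1, it does not
   exclude the zero ring. *)

end

theory Submission
  imports Defs
begin

text \<open>
  Put \<open>Z = X + Y\<close>, \<open>A\<^sub>S = X + (\<Sum>s\<in>S. x s)\<close> and \<open>T\<^sub>S = X A\<^sub>S\<^bsup>|S|-1\<^esup>\<close>, so that \<open>Y - (\<Sum>s\<in>S. x s) = Z - A\<^sub>S\<close>
  commutes with \<open>A\<^sub>S\<close>. One first shows that the sum of all \<open>T\<^sub>S (Z - A\<^sub>S)\<^bsup>n-|S|\<^esup>\<close> is \<open>Z\<^bsup>n\<^esup>\<close>:
  expanding in the central element \<open>Z\<close>, the coefficient belonging to a proper subset \<open>J\<close> of \<open>V\<close> is,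
  up to the left factor \<open>X\<close>, an alternating sum of \<open>A\<^sub>S\<^bsup>|V-J|-1\<^esup>\<close> over \<open>S \<subseteq> V - J\<close>, that is, a finite
  difference of order exceeding the degree. The theorem then follows by writing the factor
  \<open>Y - (\<Sum>s\<in>V. x s)\<close> as \<open>(Z - A\<^sub>S) - (\<Sum>t\<in>V-S. x t)\<close> and applying this identity to \<open>V\<close> and to
  each \<open>V - {t}\<close>.
\<close>

lemma center_commute:
  fixes z :: "'a::{ring, monoid_mult}"
  assumes "z \<in> center"
  shows "z * a = a * z"
  using assms by (simp add: center_def)

lemma center_power:
  fixes z :: "'a::{ring, monoid_mult}"
  assumes "z \<in> center"
  shows "z ^ k \<in> center"
proof (induction k)
  case 0
  show ?case by (simp add: center_def)
next
  case (Suc k)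
  have "z ^ Suc k * a = a * z ^ Suc k" for a
  proof -
    have "z ^ Suc k * a = z * (a * z ^ k)"
      by (simp add: mult.assoc center_commute[OF Suc])
    also have "\<dots> = a * z * z ^ k"
      by (simp only: mult.assoc[symmetric] center_commute[OF assms, of a])
    also have "\<dots> = a * z ^ Suc k"
      by (simp add: mult.assoc)
    finally show ?thesis .
  qed
  then show ?case
    by (simp add: center_def)
qed

lemma sum_Pow_insert:
  fixes g :: "'b set \<Rightarrow> 'a::comm_monoid_add"
  assumes "finite W" and "t \<notin> W"
  shows "(\<Sum>S\<in>Pow (insert t W). g S) = (\<Sum>S\<in>Pow W. g S) + (\<Sum>S\<in>Pow W. g (insert t S))"
proof -
  have "inj_on (insert t) (Pow W)"
    using assms(2) by (auto simp: inj_on_def)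
  moreover have "Pow W \<inter> insert t ` Pow W = {}"
    using assms(2) by auto
  ultimately show ?thesis
    using assms(1) by (simp add: Pow_insert sum.union_disjoint sum.reindex)
qed

text \<open>A pair with \<open>t \<in> S\<close> is encoded by \<open>t\<close> and
  \<open>S - {t}\<close>, so that a sum over sets containing \<open>t\<close> becomes one over all
  subsets of a smaller set.\<close>

lemma sum_Pow_mem_swap:
  fixes g :: "'b set \<Rightarrow> 'b \<Rightarrow> 'a::comm_monoid_add"
  assumes "finite W"
  shows "(\<Sum>S\<in>Pow W. \<Sum>t\<in>S. g S t) = (\<Sum>t\<in>W. \<Sum>S\<in>Pow (W - {t}). g (insert t S) t)"
proof -
  have "(\<Sum>S\<in>Pow W. \<Sum>t\<in>S. g S t) = (\<Sum>S\<in>Pow W. \<Sum>t\<in>{t \<in> W. t \<in> S}. g S t)"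
    by (intro sum.cong) auto
  also have "\<dots> = (\<Sum>t\<in>W. \<Sum>S | S \<in> Pow W \<and> t \<in> S. g S t)"
    using assms by (intro sum.swap_restrict) auto
  also have "\<dots> = (\<Sum>t\<in>W. \<Sum>S\<in>Pow (W - {t}). g (insert t S) t)"
  proof (rule sum.cong[OF refl])
    fix t assume "t \<in> W"
    then show "(\<Sum>S | S \<in> Pow W \<and> t \<in> S. g S t) = (\<Sum>S\<in>Pow (W - {t}). g (insert t S) t)"
      by (intro sum.reindex_bij_witness[where i = "insert t" and j = "\<lambda>S. S - {t}"])
         (auto simp: insert_absorb)
  qed
  finally show ?thesis .
qed

lemma sum_Pow_Diff_swap:
  fixes g :: "'b set \<Rightarrow> 'b \<Rightarrow> 'a::comm_monoid_add"
  assumes "finite W"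
  shows "(\<Sum>S\<in>Pow W. \<Sum>t\<in>W - S. g S t) = (\<Sum>t\<in>W. \<Sum>S\<in>Pow (W - {t}). g S t)"
proof -
  have "(\<Sum>S\<in>Pow W. \<Sum>t\<in>W - S. g S t) = (\<Sum>S\<in>Pow W. \<Sum>t\<in>{t \<in> W. t \<notin> S}. g S t)"
    by (intro sum.cong) auto
  also have "\<dots> = (\<Sum>t\<in>W. \<Sum>S | S \<in> Pow W \<and> t \<notin> S. g S t)"
    using assms by (intro sum.swap_restrict) auto
  also have "\<dots> = (\<Sum>t\<in>W. \<Sum>S\<in>Pow (W - {t}). g S t)"
    by (intro sum.cong) auto
  finally show ?thesis .
qed

lemma sum_Pow_disjoint_swap:
  fixes g :: "'b set \<Rightarrow> 'b set \<Rightarrow> 'a::comm_monoid_add"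
  assumes "finite W"
  shows "(\<Sum>S\<in>Pow W. \<Sum>J\<in>Pow (W - S). g S J) = (\<Sum>J\<in>Pow W. \<Sum>S\<in>Pow (W - J). g S J)"
proof -
  have "(\<Sum>S\<in>Pow W. \<Sum>J\<in>Pow (W - S). g S J) = (\<Sum>S\<in>Pow W. \<Sum>J\<in>{J \<in> Pow W. S \<inter> J = {}}. g S J)"
    by (intro sum.cong) auto
  also have "\<dots> = (\<Sum>J\<in>Pow W. \<Sum>S | S \<in> Pow W \<and> S \<inter> J = {}. g S J)"
    using assms by (intro sum.swap_restrict) auto
  also have "\<dots> = (\<Sum>J\<in>Pow W. \<Sum>S\<in>Pow (W - J). g S J)"
    by (intro sum.cong) auto
  finally show ?thesis .
qed

text \<open>The library's \<open>power_minus\<close> requires a nontrivial ring.\<close>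

lemma power_minus_eq:
  fixes a :: "'a::{ring, monoid_mult}"
  shows "(- a) ^ k = (- 1) ^ k * a ^ k"
proof (induction k)
  case 0
  show ?case by simp
next
  case (Suc k)
  have "(- a) ^ Suc k = - ((- a) ^ k * a)"
    unfolding power_Suc2 by simp
  also have "\<dots> = - ((- 1) ^ k * (a ^ k * a))"
    by (simp only: Suc mult.assoc)
  also have "\<dots> = (- 1) ^ Suc k * a ^ Suc k"
    by (simp add: power_commutes)
  finally show ?case .
qed

text \<open>
  Summing over subsets in place of using binomial coefficients avoids the embedding of the
  naturals, which the library only has for nontrivial rings.
\<close>

lemma power_diff_central_expand:
  fixes z a :: "'a::{ring, monoid_mult}"
  assumes "z \<in> center" and "finite U"
  shows "(z - a) ^ card U = (\<Sum>J\<in>Pow U. z ^ card J * (- a) ^ card (U - J))"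
  using assms(2)
proof (induction U)
  case empty
  show ?case by simp
next
  case (insert u U)
  let ?g = "\<lambda>U J. z ^ card J * (- a) ^ card (U - J)"
  have in_J: "?g (insert u U) (insert u J) = z * ?g U J" if "J \<in> Pow U" for J
  proof -
    have "finite J" "u \<notin> J" "insert u U - insert u J = U - J"
      using that insert.hyps by (auto intro: finite_subset)
    then show ?thesis by (simp add: mult.assoc)
  qed
  \<comment> \<open>Here \<open>u\<close> contributes \<open>- a\<close> from the new factor
    \<open>z - a\<close>; centrality of \<open>z\<close> lets this factor move to the front.\<close>
  have out_J: "?g (insert u U) J = - a * ?g U J" if "J \<in> Pow U" for J
  proof -
    have "insert u U - J = insert u (U - J)" "u \<notin> U - J"
      using that insert.hyps by auto
    then have "?g (insert u U) J = z ^ card J * (- a * (- a) ^ card (U - J))"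
      using insert.hyps by simp
    also have "\<dots> = - a * ?g U J"
      by (metis center_commute[OF center_power[OF assms(1)]] mult.assoc)
    finally show ?thesis .
  qed
  have "(\<Sum>J\<in>Pow (insert u U). ?g (insert u U) J)
      = (\<Sum>J\<in>Pow U. - a * ?g U J) + (\<Sum>J\<in>Pow U. z * ?g U J)"
    unfolding sum_Pow_insert[OF insert.hyps]
    by (intro arg_cong2[where f = "(+)"] sum.cong refl in_J out_J)
  also have "\<dots> = (z - a) * (z - a) ^ card U"
    by (simp only: sum_distrib_left[symmetric] insert.IH distrib_right[symmetric]) simp
  finally show ?case
    using insert.hyps by simp
qed

text \<open>Induction on \<open>k\<close>, splitting off the rightmost factor
  \<open>X + sum x S\<close>. Its \<open>X\<close> part leaves the sum with exponent
  \<open>k\<close> over \<open>W\<close>. The coefficient of each \<open>x t\<close> comes from the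
  sets containing \<open>t\<close>, and is the sum over \<open>W - {t}\<close> with
  \<open>X + x t\<close> in place of \<open>X\<close>; hence \<open>X\<close> must be
  arbitrary.\<close>

lemma alternating_sum_power_eq_0:
  fixes x :: "'b \<Rightarrow> 'a::{ring, monoid_mult}"
  assumes "finite W" and "k < card W"
  shows "(\<Sum>S\<in>Pow W. (- 1) ^ card (W - S) * (X + sum x S) ^ k) = 0"
  using assms
proof (induction k arbitrary: W X)
  case 0
  then obtain t where "t \<in> W"
    by fastforce
  define U where "U = W - {t}"
  have W: "W = insert t U" "finite U" "t \<notin> U"
    using \<open>t \<in> W\<close> 0 by (auto simp: U_def)
  \<comment> \<open>Subsets of \<open>W\<close> cancel in pairs differing only in
    \<open>t\<close>.\<close>
  have "(- 1) ^ card (W - S) + (- 1) ^ card (W - insert t S) = (0 :: 'a)" if "S \<in> Pow U" for S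
  proof -
    have "W - S = insert t (U - S)" "t \<notin> U - S" "W - insert t S = U - S"
      using that W by auto
    then show ?thesis using W(2) by simp
  qed
  then show ?case
    using sum_Pow_insert[OF W(2,3), of "\<lambda>S. (- 1) ^ card (W - S) :: 'a"] W(1)
    by (simp add: sum.distrib[symmetric])
next
  case (Suc k)
  let ?f = "\<lambda>W X S. (- 1) ^ card (W - S) * (X + sum x S) ^ k"
  have *: "(\<Sum>S\<in>Pow (W - {t}). ?f W X (insert t S)) = 0" if "t \<in> W" for t
  proof -
    have "?f W X (insert t S) = ?f (W - {t}) (X + x t) S" if "S \<in> Pow (W - {t})" for S
    proof -
      have "W - insert t S = W - {t} - S" "t \<notin> S" "finite S"
        using that Suc.prems by (auto intro: finite_subset)
      then show ?thesis by (simp add: add.assoc)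
    qed
    then have "(\<Sum>S\<in>Pow (W - {t}). ?f W X (insert t S))
        = (\<Sum>S\<in>Pow (W - {t}). ?f (W - {t}) (X + x t) S)"
      by (rule sum.cong[OF refl])
    also have "\<dots> = 0"
      using Suc.prems that by (intro Suc.IH) auto
    finally show ?thesis .
  qed
  have "(\<Sum>S\<in>Pow W. (- 1) ^ card (W - S) * (X + sum x S) ^ Suc k)
      = (\<Sum>S\<in>Pow W. ?f W X S * X + (\<Sum>t\<in>S. ?f W X S * x t))"
    by (simp only: power_Suc2 mult.assoc[symmetric] distrib_left sum_distrib_left)
  also have "\<dots> = (\<Sum>S\<in>Pow W. ?f W X S) * X
      + (\<Sum>t\<in>W. (\<Sum>S\<in>Pow (W - {t}). ?f W X (insert t S)) * x t)"
    by (simp only: sum.distrib sum_Pow_mem_swap[OF Suc.prems(1)] sum_distrib_right)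
  also have "\<dots> = 0"
    using * Suc.IH[of W X] Suc.prems by simp
  finally show ?case .
qed

lemma abel_hurwitz_central:
  fixes x :: "'b \<Rightarrow> 'a::{ring, monoid_mult}"
  assumes "finite V" and "Z \<in> center"
  shows "(\<Sum>S\<in>Pow V. (if S = {} then 1 else X * (X + sum x S) ^ (card S - 1))
            * (Z - (X + sum x S)) ^ card (V - S)) = Z ^ card V"
proof -
  define A where "A S = X + sum x S" for S
  define T where "T S = (if S = {} then 1 else X * A S ^ (card S - 1))" for S
  have coeff: "(\<Sum>S\<in>Pow W. T S * (- A S) ^ card (W - S)) = 0" if W: "finite W" "W \<noteq> {}" for W
  proof -
    \<comment> \<open>The total exponent \<open>card W - 1\<close> does not depend on
      \<open>S\<close>. For empty \<open>S\<close> the factor \<open>X\<close> is taken out of the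
      power of \<open>- X\<close>, since \<open>T {} = 1\<close>.\<close>
    have "T S * (- A S) ^ card (W - S) = X * ((- 1) ^ card (W - S) * A S ^ (card W - 1))"
      if S: "S \<in> Pow W" for S
    proof (cases "S = {}")
      case True
      obtain m where m: "card W = Suc m"
        using W by (metis card_gt_0_iff gr0_conv_Suc)
      have "(- X) ^ Suc m = X * (- ((- X) ^ m))"
        by simp
      also have "\<dots> = X * ((- 1) ^ Suc m * X ^ m)"
        by (simp add: power_minus_eq[of X])
      finally show ?thesis
        using True m by (simp add: T_def A_def)
    next
      case False
      have fin: "finite S" "card S \<le> card W" "card S > 0"
        using S W False by (auto intro: finite_subset card_mono simp: card_gt_0_iff)
      have exps: "card S - 1 + card (W - S) = card W - 1"
        using fin S by (simp add: card_Diff_subset)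
      have sign: "a * ((- 1) ^ k * b) = (- 1) ^ k * (a * b)" for a b :: 'a and k
        by (induction k) simp_all
      have "A S ^ (card S - 1) * (- A S) ^ card (W - S)
          = (- 1) ^ card (W - S) * A S ^ (card W - 1)"
        unfolding power_minus_eq[of "A S"] sign power_add[symmetric] exps ..
      then show ?thesis
        using False by (simp add: T_def mult.assoc)
    qed
    then have "(\<Sum>S\<in>Pow W. T S * (- A S) ^ card (W - S))
        = X * (\<Sum>S\<in>Pow W. (- 1) ^ card (W - S) * A S ^ (card W - 1))"
      by (simp add: sum_distrib_left)
    also have "\<dots> = 0"
      unfolding A_def using W
      by (subst alternating_sum_power_eq_0) (auto simp: card_gt_0_iff)
    finally show ?thesis .
  qed
  have "T S * (Z - A S) ^ card (V - S)
      = (\<Sum>J\<in>Pow (V - S). Z ^ card J * (T S * (- A S) ^ card (V - J - S)))" for S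
  proof -
    have "V - S - J = V - J - S" for J
      by auto
    then have "T S * (Z ^ card J * (- A S) ^ card (V - S - J))
        = Z ^ card J * (T S * (- A S) ^ card (V - J - S))" for J
      by (metis center_commute[OF center_power[OF assms(2)]] mult.assoc)
    then show ?thesis
      using assms by (simp add: power_diff_central_expand sum_distrib_left)
  qed
  then have "(\<Sum>S\<in>Pow V. T S * (Z - A S) ^ card (V - S))
      = (\<Sum>S\<in>Pow V. \<Sum>J\<in>Pow (V - S). Z ^ card J * (T S * (- A S) ^ card (V - J - S)))"
    by simp
  also have "\<dots> = (\<Sum>J\<in>Pow V. Z ^ card J * (\<Sum>S\<in>Pow (V - J). T S * (- A S) ^ card (V - J - S)))"
    unfolding sum_distrib_left by (rule sum_Pow_disjoint_swap[OF assms(1)])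
  \<comment> \<open>By \<open>coeff\<close> with \<open>W = V - J\<close> only \<open>J = V\<close>
    survives, where the inner sum is the single term \<open>T {} = 1\<close>.\<close>
  also have "\<dots> = (\<Sum>J\<in>{V}. Z ^ card J * (\<Sum>S\<in>Pow (V - J). T S * (- A S) ^ card (V - J - S)))"
  proof (rule sum.mono_neutral_right)
    show "\<forall>J\<in>Pow V - {V}. Z ^ card J * (\<Sum>S\<in>Pow (V - J). T S * (- A S) ^ card (V - J - S)) = 0"
    proof
      fix J assume "J \<in> Pow V - {V}"
      then have "finite (V - J)" "V - J \<noteq> {}"
        using assms(1) by auto
      then show "Z ^ card J * (\<Sum>S\<in>Pow (V - J). T S * (- A S) ^ card (V - J - S)) = 0"
        by (subst coeff) simp_all
    qed
  qed (use assms(1) in auto)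
  also have "\<dots> = Z ^ card V"
    by (simp add: T_def)
  finally show ?thesis
    unfolding T_def A_def .
qed

theorem theorem2p6:
  fixes V :: "'b set"
    and n :: nat
    and x :: "'b \<Rightarrow> 'a::{ring, monoid_mult}"
    and X Y :: 'a
  assumes "finite V"
    and "n = card V"
    and "X + Y \<in> center"
  shows "(\<Sum>S\<in>Pow V.
            (if S = {} then 1
             else X * (X + (\<Sum>s\<in>S. x s)) ^ (card S - 1)) *
            (if card S = n then 1
             else (Y - (\<Sum>s\<in>S. x s)) ^ (n - card S - 1) * (Y - (\<Sum>s\<in>V. x s))))
       = (if n = 0 then 1
          else (X + Y - (\<Sum>s\<in>V. x s)) * (X + Y) ^ (n - 1))"
proof (cases "n = 0")
  case True
  then show ?thesis
    using assms by simp
next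
  case False
  define Z where "Z = X + Y"
  define T where "T S = (if S = {} then 1 else X * (X + sum x S) ^ (card S - 1))" for S
  define B where "B S = Y - sum x S" for S
  have Z: "Z \<in> center"
    using assms(3) by (simp add: Z_def)
  have B: "B S = Z - (X + sum x S)" for S
    by (simp add: B_def Z_def algebra_simps)
  have abel: "(\<Sum>S\<in>Pow W. T S * B S ^ card (W - S)) = Z ^ card W" if "finite W" for W
    using abel_hurwitz_central[OF that Z] by (simp add: T_def B)
  \<comment> \<open>The exponent is written as \<open>card (V - {t} - S)\<close> to match
    \<open>abel\<close> for \<open>V - {t}\<close>. For \<open>S = V\<close> the difference is
    empty, which agrees with the convention that the second factor is 1.\<close>
  have summand: "T S * (if card S = n then 1 else B S ^ (n - card S - 1) * B V)
      = T S * B S ^ card (V - S) - (\<Sum>t\<in>V - S. T S * B S ^ card (V - {t} - S) * x t)"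
    if S: "S \<in> Pow V" for S
  proof (cases "S = V")
    case True
    then show ?thesis using assms by simp
  next
    case False
    have fin: "finite S" "card S < n"
      using S False assms(1,2) by (auto intro: finite_subset psubset_card_mono)
    obtain k where k: "card (V - S) = Suc k" "n - card S - 1 = k"
      using fin S assms(2) by (simp add: card_Diff_subset) (metis Suc_diff_Suc)
    have B_V: "B V = B S - (\<Sum>t\<in>V - S. x t)"
      using S assms(1) by (simp add: B_def sum.subset_diff[of S V] algebra_simps)
    have "card (V - {t} - S) = k" if "t \<in> V - S" for t
    proof -
      have "V - {t} - S = V - S - {t}" by auto
      then show ?thesis using that k assms(1) by simp
    qed
    then have "(\<Sum>t\<in>V - S. T S * B S ^ card (V - {t} - S) * x t) = T S * B S ^ k * (\<Sum>t\<in>V - S. x t)"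
      by (simp add: sum_distrib_left)
    then show ?thesis
      using fin(2) by (simp only: k B_V power_Suc2 mult.assoc)
        (simp add: right_diff_distrib)
  qed
  \<comment> \<open>Exchanging the sums fixes \<open>t\<close> and lets \<open>S\<close> run over
    the sets avoiding it. Each \<open>x t\<close> stays on the right, so it factors out without
    commuting with anything.\<close>
  have "(\<Sum>S\<in>Pow V. T S * (if card S = n then 1 else B S ^ (n - card S - 1) * B V))
      = (\<Sum>S\<in>Pow V. T S * B S ^ card (V - S))
        - (\<Sum>t\<in>V. (\<Sum>S\<in>Pow (V - {t}). T S * B S ^ card (V - {t} - S)) * x t)"
    by (simp add: summand sum_subtractf sum_Pow_Diff_swap[OF assms(1)] sum_distrib_right)
  also have "\<dots> = Z ^ n - (\<Sum>t\<in>V. Z ^ (n - 1) * x t)"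
    using assms(1,2) by (simp add: abel)
  also have "\<dots> = Z ^ (n - 1) * (Z - sum x V)"
    using False by (cases n) (simp_all add: right_diff_distrib sum_distrib_left power_commutes)
  \<comment> \<open>Centrality of \<open>Z\<close> restores the order of factors in the
    claim.\<close>
  also have "\<dots> = (Z - sum x V) * Z ^ (n - 1)"
    by (rule center_commute[OF center_power[OF Z]])
  finally show ?thesis
    using False unfolding T_def B_def Z_def by simp
qed

end
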